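(* There exists a constant $C>0$ such that for every $s>2$ it holds $$\int_{\mathbb{S}^{N-1}}\left(\int_{\frac{s}{2}}^{2s}\int_{\mathbb{S}^{N-1}}\chi_{\{|s\xi+r\theta|<1\}}(\theta)\,d\mu(\theta)\,\frac{dr}{r^{1+\alpha}}\right)^{\frac{N}{\alpha}}d\xi\ \le\ \frac{C}{s^{2N-1}}.$$
   Context: Let $N\ge2$ and $0<\alpha<2$. Let $\mu$ be a nonnegative Borel measure on the unit sphere $\mathbb{S}^{N-1}\subset\mathbb{R}^N$ that is finite, $\mu(\mathbb{S}^{N-1})<\infty$, symmetric, $d\mu(\theta)=d\mu(-\theta)$, and non-degenerate: $\inf_{\zeta\in\mathbb{S}^{N-1}}\int_{\mathbb{S}^{N-1}}|\zeta\cdot\theta|^\alpha\,d\mu(\theta)\ge c_0>0$. Here $d\xi$ denotes the surface measure on $\mathbb{S}^{N-1}$ and, for fixed $s,\xi,r$, $\chi_{\{|s\xi+r\theta|<1\}}(\theta)$ is the indicator function of the set of $\theta\in\mathbb{S}^{N-1}$ with $|s\xi+r\theta|<1$. *)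

theory Defs
  imports "HOL-Analysis.Analysis"
begin

text \<open>
  Surface measure of the unit sphere, given by polar coordinates: the measure of a Borel
  set \<open>A\<close> of directions is the dimension times the Lebesgue volume of the cone
  \<open>{r \<theta> | \<theta> \<in> A, 0 < r < 1}\<close>, the factor coming from \<open>\<integral>\<^sub>0\<^sup>1 r^(N-1) dr = 1/N\<close>.
  Note \<open>sgn x = x / norm x\<close>.
\<close>

definition sphere_surface_measure :: "'a::euclidean_space measure" where
  "sphere_surface_measure =
     scale_measure (of_nat DIM('a))
       (distr (restrict_space lborel (ball 0 1 - {0}))
              (restrict_space borel (sphere 0 1)) sgn)"

text \<open>Real powers on \<open>[0, \<infinity>]\<close>; only meant for positive exponents.\<close>

definition ennreal_powr :: "ennreal \<Rightarrow> real \<Rightarrow> ennreal" where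
  "ennreal_powr x p = (if x = \<infinity> then \<infinity> else ennreal (enn2real x powr p))"

lemma space_sphere_surface_measure [simp]:
  "space (sphere_surface_measure :: 'a::euclidean_space measure) = sphere 0 1"
  by (simp add: sphere_surface_measure_def space_restrict_space space_scale_measure)

lemma sets_sphere_surface_measure [simp, measurable_cong]:
  "sets (sphere_surface_measure :: 'a::euclidean_space measure)
     = sets (restrict_space borel (sphere 0 1))"
  by (simp add: sphere_surface_measure_def)

lemma emeasure_sphere_surface_measure:
  fixes A :: "'a::euclidean_space set"
  assumes "A \<in> sets (restrict_space borel (sphere 0 1))"
  shows "emeasure sphere_surface_measure A
           = of_nat DIM('a) * emeasure lborel {x \<in> ball 0 1 - {0}. sgn x \<in> A}"
proof -
  have "sgn \<in> borel_measurable (borel :: 'a measure)"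
    unfolding sgn_div_norm by measurable
  then have "sgn \<in> measurable (restrict_space lborel (ball 0 1 - {0 :: 'a}))
                           (restrict_space borel (sphere 0 1))"
    by (intro measurable_restrict_space2 measurable_restrict_space1)
       (auto simp: space_restrict_space norm_sgn)
  moreover have "sgn -` A \<inter> (ball 0 1 - {0}) = {x \<in> ball 0 1 - {0}. sgn x \<in> A}"
    by auto
  moreover have "emeasure (restrict_space lborel (ball 0 1 - {0})) {x \<in> ball 0 1 - {0}. sgn x \<in> A}
      = emeasure lborel {x \<in> ball 0 1 - {0}. sgn x \<in> A}"
    by (rule emeasure_restrict_space) auto
  ultimately show ?thesis
    using assms
    by (simp add: sphere_surface_measure_def emeasure_distr space_restrict_space)
qed

end

theory Submission
  imports Defs
begin

text \<open>
  If \<open>\<bar>s \<xi> + r \<theta>\<bar> < 1\<close> with unit vectors \<open>\<xi>, \<theta>\<close>, then \<open>\<bar>r - s\<bar> < 1\<close> and \<open>\<bar>\<xi> + \<theta>\<bar> < 2 / s\<close>. So the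
  integral over \<open>r\<close> is at most a multiple of \<open>s powr (-1 - \<alpha>)\<close> times the \<open>\<mu>\<close>-measure of the cap
  of radius \<open>2 / s\<close> around \<open>-\<xi>\<close>. As \<open>N / \<alpha> \<ge> 1\<close> and \<open>\<mu>\<close> is finite, the \<open>N / \<alpha>\<close>-th power
  of that measure is bounded by a multiple of the measure itself. By Tonelli, integrating over
  \<open>\<xi>\<close> leaves the surface measure of a cap of radius \<open>2 / s\<close>, which is
  \<open>O(s\<^bsup>1-N\<^esup>)\<close>. Altogether this gives \<open>O(s powr (-N/\<alpha> - N - (N - 1)))\<close>.
\<close>

section \<open>Geometry of nearly opposite directions\<close>

text \<open>The reverse triangle inequality compares the lengths \<open>s\<close> and
  \<open>r\<close>. Replacing \<open>r\<close> by \<open>s\<close> in front of \<theta> then costs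
  at most another \<open>d\<close>, hence the factor 2.\<close>

lemma norm_scaleR_add_scaleR_less:
  fixes \<xi> \<theta> :: "'a::real_normed_vector"
  assumes "norm \<xi> = 1" "norm \<theta> = 1" "0 < s" "0 \<le> r" "norm (s *\<^sub>R \<xi> + r *\<^sub>R \<theta>) < d"
  shows "\<bar>r - s\<bar> < d" "norm (\<xi> + \<theta>) < 2 * d / s"
proof -
  have "\<bar>norm (s *\<^sub>R \<xi>) - norm (- (r *\<^sub>R \<theta>))\<bar> \<le> norm (s *\<^sub>R \<xi> - (- (r *\<^sub>R \<theta>)))"
    by (rule norm_triangle_ineq3)
  then show *: "\<bar>r - s\<bar> < d"
    using assms by simp
  have "s * norm (\<xi> + \<theta>) = norm ((s *\<^sub>R \<xi> + r *\<^sub>R \<theta>) + (s - r) *\<^sub>R \<theta>)"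
    using assms by (simp add: algebra_simps flip: scaleR_add_right)
  also have "\<dots> \<le> norm (s *\<^sub>R \<xi> + r *\<^sub>R \<theta>) + \<bar>s - r\<bar>"
    using norm_triangle_ineq[of "s *\<^sub>R \<xi> + r *\<^sub>R \<theta>" "(s - r) *\<^sub>R \<theta>"] assms by simp
  also have "\<dots> < 2 * d"
    using * assms by linarith
  finally show "norm (\<xi> + \<theta>) < 2 * d / s"
    using assms by (simp add: field_simps)
qed

section \<open>Surface measure of small caps\<close>

text \<open>The cone over the cap lies within distance \<open>\<delta>\<close> of the segment from \<open>0\<close> to \<open>\<theta>\<close>, so
  it is covered by \<open>O(1/\<delta>)\<close> balls of radius comparable to \<open>\<delta>\<close>.\<close>

lemma emeasure_cone_cap_le:
  fixes \<theta> :: "'a::euclidean_space"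
  assumes "norm \<theta> = 1" "0 < \<delta>" "0 < m"
  shows "emeasure lborel {x \<in> ball 0 1 - {0}. norm (sgn x - \<theta>) < \<delta>}
           \<le> ennreal (real m * (unit_ball_vol DIM('a) * (\<delta> + 1 / real m) ^ DIM('a)))"
proof -
  \<comment> \<open>The centres are spaced \<open>1 / m\<close> apart along the segment. In the
    radius, \<delta> pays for the distance from \<open>x\<close> to
    \<open>norm x *\<^sub>R \<theta>\<close> and \<open>1 / m\<close> for rounding
    \<open>norm x\<close> down to the grid.\<close>
  let ?B = "\<lambda>k. ball ((real k / real m) *\<^sub>R \<theta>) (\<delta> + 1 / real m)"
  have "{x \<in> ball 0 1 - {0}. norm (sgn x - \<theta>) < \<delta>} \<subseteq> (\<Union>k<m. ?B k)"
  proof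
    fix x assume "x \<in> {x \<in> ball 0 1 - {0}. norm (sgn x - \<theta>) < \<delta>}"
    then have x: "norm x < 1" "x \<noteq> 0" "norm (sgn x - \<theta>) < \<delta>"
      by auto
    define k where "k = nat \<lfloor>norm x * real m\<rfloor>"
    have k: "real k \<le> norm x * real m" "norm x * real m < real k + 1"
      by (auto simp: k_def)
    have "real k < real m"
      using k(1) x(1) assms(3) mult_strict_right_mono[of "norm x" 1 "real m"] by linarith
    moreover have "norm (x - norm x *\<^sub>R \<theta>) < \<delta>"
    proof -
      have "x - norm x *\<^sub>R \<theta> = norm x *\<^sub>R (sgn x - \<theta>)"
        using x by (simp add: sgn_div_norm algebra_simps)
      then have "norm (x - norm x *\<^sub>R \<theta>) = norm x * norm (sgn x - \<theta>)"
        by simp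
      also have "\<dots> \<le> 1 * norm (sgn x - \<theta>)"
        using x by (intro mult_right_mono) auto
      finally show ?thesis
        using x by simp
    qed
    moreover have "norm (norm x *\<^sub>R \<theta> - (real k / real m) *\<^sub>R \<theta>) \<le> 1 / real m"
    proof -
      have "norm (norm x *\<^sub>R \<theta> - (real k / real m) *\<^sub>R \<theta>) = \<bar>norm x - real k / real m\<bar>"
        using assms by (simp flip: scaleR_diff_left)
      also have "\<dots> \<le> 1 / real m"
      proof -
        have "real k / real m \<le> norm x"
          using k(1) assms(3) by (simp add: pos_divide_le_eq)
        moreover have "norm x < (real k + 1) / real m"
          using k(2) assms(3) by (simp add: pos_less_divide_eq)
        ultimately show ?thesis
          by (simp add: add_divide_distrib)
      qed
      finally show ?thesis .
    qed
    ultimately have "k < m" "x \<in> ?B k"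
      using dist_triangle[of "(real k / real m) *\<^sub>R \<theta>" x "norm x *\<^sub>R \<theta>"]
      by (auto simp: dist_norm norm_minus_commute)
    then show "x \<in> (\<Union>k<m. ?B k)"
      by blast
  qed
  then have "emeasure lborel {x \<in> ball 0 1 - {0}. norm (sgn x - \<theta>) < \<delta>}
      \<le> emeasure lborel (\<Union>k<m. ?B k)"
    by (intro emeasure_mono) auto
  also have "\<dots> \<le> (\<Sum>k<m. emeasure lborel (?B k))"
    by (intro emeasure_subadditive_finite) auto
  also have "\<dots> = ennreal (real m * (unit_ball_vol DIM('a) * (\<delta> + 1 / real m) ^ DIM('a)))"
    using assms by (simp add: emeasure_ball ennreal_mult ennreal_of_nat_eq_real_of_nat)
  finally show ?thesis .
qed

text \<open>The cone over the whole sphere lies in the unit ball. Finiteness supplies the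
  sigma-finiteness that Tonelli requires.\<close>

lemma finite_measure_sphere_surface_measure:
  "finite_measure (sphere_surface_measure :: 'a::euclidean_space measure)"
proof
  have "emeasure (sphere_surface_measure :: 'a measure) (sphere 0 1)
      \<le> of_nat DIM('a) * emeasure lborel (ball (0::'a) 1)"
    by (subst emeasure_sphere_surface_measure)
       (auto intro!: mult_left_mono emeasure_mono simp: sets_restrict_space)
  also have "\<dots> < \<infinity>"
    by (simp add: emeasure_ball ennreal_mult_less_top ennreal_of_nat_eq_real_of_nat)
  finally show "emeasure (sphere_surface_measure :: 'a measure)
      (space sphere_surface_measure) \<noteq> \<infinity>"
    by simp
qed

text \<open>Covering the cone over the cap around -\<theta> by about \<open>s\<close> balls of
  radius at most \<open>3 / s\<close> gives a volume of order \<open>s * s^(-N)\<close>, uniformly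
  in \<theta>.\<close>

lemma emeasure_sphere_surface_measure_cap_le:
  "\<exists>C>0. \<forall>s\<ge>1. \<forall>\<theta>\<in>sphere 0 1.
     emeasure sphere_surface_measure {\<xi> \<in> sphere 0 1. norm (\<xi> + \<theta> :: 'a::euclidean_space) < 2 / s}
       \<le> ennreal (C / s ^ (DIM('a) - 1))"
proof -
  let ?N = "DIM('a)"
  \<comment> \<open>\<open>N\<close> is the normalisation of the surface measure, 2 comes from
    \<open>m \<le> 2 * s\<close>, and 3 from \<open>2 / s + 1 / m \<le> 3 / s\<close>.\<close>
  define C where "C = real ?N * (2 * (unit_ball_vol ?N * 3 ^ ?N))"
  have "C > 0"
    by (simp add: C_def)
  moreover have "emeasure sphere_surface_measure {\<xi> \<in> sphere 0 1. norm (\<xi> + \<theta>) < 2 / s}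
       \<le> ennreal (C / s ^ (?N - 1))" if s: "s \<ge> 1" and \<theta>: "\<theta> \<in> sphere 0 1" for s and \<theta> :: 'a
  proof -
    \<comment> \<open>Rounding up keeps \<open>1 / m \<le> 1 / s\<close>; as
      \<open>s \<ge> 1\<close>, it at most doubles \<open>s\<close>.\<close>
    define m where "m = nat \<lceil>s\<rceil>"
    have m: "s \<le> real m" "real m \<le> 2 * s" "0 < m"
      using s unfolding m_def by linarith+
    let ?A = "{\<xi> \<in> sphere 0 1. norm (\<xi> + \<theta>) < 2 / s}"
    have "open {\<xi>. norm (\<xi> + \<theta>) < 2 / s}"
      by (intro open_Collect_less continuous_intros)
    then have "?A \<in> sets (restrict_space borel (sphere 0 1))"
      unfolding sets_restrict_space image_iff
      by (intro bexI[of _ "{\<xi>. norm (\<xi> + \<theta>) < 2 / s}"]) auto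
    then have "emeasure sphere_surface_measure ?A
        = of_nat ?N * emeasure lborel {x \<in> ball 0 1 - {0}. sgn x \<in> ?A}"
      by (rule emeasure_sphere_surface_measure)
    also have "{x \<in> ball 0 1 - {0}. sgn x \<in> ?A} = {x \<in> ball 0 1 - {0}. norm (sgn x - (- \<theta>)) < 2 / s}"
      by (auto simp: norm_sgn)
    also have "emeasure lborel \<dots>
        \<le> ennreal (real m * (unit_ball_vol ?N * (2 / s + 1 / real m) ^ ?N))"
      using s \<theta> m by (intro emeasure_cone_cap_le) auto
    also have "real m * (unit_ball_vol ?N * (2 / s + 1 / real m) ^ ?N)
        \<le> (2 * s) * (unit_ball_vol ?N * (3 / s) ^ ?N)"
    proof (intro mult_mono power_mono)
      have "1 / real m \<le> 1 / s"
        using m s by (intro divide_left_mono) auto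
      then show "2 / s + 1 / real m \<le> 3 / s"
        by (simp add: field_simps)
    qed (use m s in auto)
    also have "(2 * s) * (unit_ball_vol ?N * (3 / s) ^ ?N)
        = 2 * (unit_ball_vol ?N * 3 ^ ?N) / s ^ (?N - 1)"
      using s by (simp add: power_divide field_simps flip: power_Suc)
    finally show ?thesis
      using s
      by (simp add: C_def mult_left_mono ennreal_leI ennreal_of_nat_eq_real_of_nat flip: ennreal_mult)
  qed
  ultimately show ?thesis
    by blast
qed

section \<open>Averaging the cap mass over all directions\<close>

text \<open>Joint measurability of the cap relation, so that both of its families of sections can be
  integrated. The sets of both factors are traces of Borel sets, so the inclusions into
  \<open>borel\<close> are measurable.\<close>

lemma sets_pair_cap:
  fixes M M' :: "'a::euclidean_space measure"
  assumes "sets M = sets (restrict_space borel (sphere 0 1))"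
    and "sets M' = sets (restrict_space borel (sphere 0 1))"
  shows "{z \<in> sphere 0 1 \<times> sphere 0 1. norm (fst z + snd z) < d} \<in> sets (M \<Otimes>\<^sub>M M')"
proof -
  have [measurable]: "(\<lambda>x. x) \<in> measurable M borel" "(\<lambda>x. x) \<in> measurable M' borel"
    by (auto simp: measurable_cong_sets[OF assms(1) refl] measurable_cong_sets[OF assms(2) refl]
        intro!: measurable_restrict_space1)
  have [measurable]: "fst \<in> borel_measurable (M \<Otimes>\<^sub>M M')" "snd \<in> borel_measurable (M \<Otimes>\<^sub>M M')"
    using measurable_compose[OF measurable_fst, of "\<lambda>x. x" _ borel]
      measurable_compose[OF measurable_snd, of "\<lambda>x. x" _ borel] by measurable
  have "{z \<in> space (M \<Otimes>\<^sub>M M'). norm (fst z + snd z) < d} \<in> sets (M \<Otimes>\<^sub>M M')"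
    by measurable
  then show ?thesis
    using sets_eq_imp_space_eq[OF assms(1)] sets_eq_imp_space_eq[OF assms(2)]
    by (simp add: space_pair_measure space_restrict_space)
qed

text \<open>The caps are the sections of one measurable set in the product. This measurability later
  allows a constant to be pulled out of the integral over \<xi>.\<close>

lemma borel_measurable_emeasure_cap:
  fixes \<mu> :: "'a::euclidean_space measure"
  assumes "sets \<mu> = sets (restrict_space borel (sphere 0 1))" "sigma_finite_measure \<mu>"
  shows "(\<lambda>\<xi>. emeasure \<mu> {\<theta> \<in> sphere 0 1. norm (\<xi> + \<theta>) < d})
           \<in> borel_measurable sphere_surface_measure"
proof -
  let ?Q = "{z \<in> sphere 0 1 \<times> sphere 0 1. norm (fst z + snd z :: 'a) < d}"
  have "(\<lambda>\<xi>. emeasure \<mu> (Pair \<xi> -` ?Q)) \<in> borel_measurable sphere_surface_measure"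
    using sets_pair_cap[OF sets_sphere_surface_measure assms(1)]
    by (rule sigma_finite_measure.measurable_emeasure_Pair[OF assms(2)])
  moreover have "Pair \<xi> -` ?Q = {\<theta> \<in> sphere 0 1. norm (\<xi> + \<theta>) < d}" if "\<xi> \<in> sphere 0 1" for \<xi>
    using that by auto
  ultimately show ?thesis
    by (subst measurable_cong[of _ _ "\<lambda>\<xi>. emeasure \<mu> (Pair \<xi> -` ?Q)"]) auto
qed

text \<open>The relation \<open>norm (\<xi> + \<theta>) < 2 / s\<close> is symmetric, so Tonelli
  turns \<mu>-masses of caps into surface measures of caps. Their bound is uniform in \<theta> and
  only gets multiplied by the total mass of \<mu>.\<close>

lemma nn_integral_emeasure_cap_le:
  fixes \<mu> :: "'a::euclidean_space measure"
  assumes "sets \<mu> = sets (restrict_space borel (sphere 0 1))" "finite_measure \<mu>"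
  shows "\<exists>C>0. \<forall>s\<ge>1.
    (\<integral>\<^sup>+\<xi>. emeasure \<mu> {\<theta> \<in> sphere 0 1. norm (\<xi> + \<theta>) < 2 / s} \<partial>sphere_surface_measure)
      \<le> ennreal (C / s ^ (DIM('a) - 1))"
proof -
  let ?S = "sphere_surface_measure :: 'a measure"
  obtain C where C: "C > 0" "\<And>s \<theta>. s \<ge> 1 \<Longrightarrow> \<theta> \<in> sphere 0 1 \<Longrightarrow>
     emeasure ?S {\<xi> \<in> sphere 0 1. norm (\<xi> + \<theta>) < 2 / s} \<le> ennreal (C / s ^ (DIM('a) - 1))"
    using emeasure_sphere_surface_measure_cap_le[where 'a='a] by blast
  interpret \<mu>: finite_measure \<mu> by fact
  interpret S: finite_measure ?S
    by (rule finite_measure_sphere_surface_measure)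
  interpret P: pair_sigma_finite ?S \<mu> ..
  have sp: "space \<mu> = sphere 0 1"
    using sets_eq_imp_space_eq[OF assms(1)] by (simp add: space_restrict_space)
  \<comment> \<open>The summand 1 makes the constant positive even if \<mu> has mass 0.\<close>
  define C' where "C' = C * (measure \<mu> (sphere 0 1) + 1)"
  have "C' > 0"
    using C(1) by (simp add: C'_def add_nonneg_pos)
  moreover have "(\<integral>\<^sup>+\<xi>. emeasure \<mu> {\<theta> \<in> sphere 0 1. norm (\<xi> + \<theta>) < 2 / s} \<partial>?S)
      \<le> ennreal (C' / s ^ (DIM('a) - 1))" if s: "s \<ge> 1" for s
  proof -
    define Q where "Q = {z \<in> sphere 0 1 \<times> sphere 0 1. norm (fst z + snd z :: 'a) < 2 / s}"
    have Q: "Q \<in> sets (?S \<Otimes>\<^sub>M \<mu>)"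
      unfolding Q_def by (intro sets_pair_cap sets_sphere_surface_measure assms(1))
    have "(\<integral>\<^sup>+\<xi>. emeasure \<mu> {\<theta> \<in> sphere 0 1. norm (\<xi> + \<theta>) < 2 / s} \<partial>?S)
        = (\<integral>\<^sup>+\<xi>. emeasure \<mu> (Pair \<xi> -` Q) \<partial>?S)"
      by (intro nn_integral_cong arg_cong[where f = "emeasure \<mu>"]) (auto simp: Q_def)
    also have "\<dots> = emeasure (?S \<Otimes>\<^sub>M \<mu>) Q"
      by (rule \<mu>.emeasure_pair_measure_alt[OF Q, symmetric])
    also have "\<dots> = (\<integral>\<^sup>+\<theta>. emeasure ?S ((\<lambda>\<xi>. (\<xi>, \<theta>)) -` Q) \<partial>\<mu>)"
      by (rule P.emeasure_pair_measure_alt2[OF Q])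
    also have "\<dots> \<le> (\<integral>\<^sup>+\<theta>. ennreal (C / s ^ (DIM('a) - 1)) \<partial>\<mu>)"
    proof (intro nn_integral_mono)
      fix \<theta> assume "\<theta> \<in> space \<mu>"
      then have "\<theta> \<in> sphere 0 1"
        by (simp add: sp)
      moreover from this have "(\<lambda>\<xi>. (\<xi>, \<theta>)) -` Q = {\<xi> \<in> sphere 0 1. norm (\<xi> + \<theta>) < 2 / s}"
        by (auto simp: Q_def)
      ultimately show "emeasure ?S ((\<lambda>\<xi>. (\<xi>, \<theta>)) -` Q) \<le> ennreal (C / s ^ (DIM('a) - 1))"
        using C(2)[OF s] by simp
    qed
    also have "\<dots> = ennreal (C * measure \<mu> (sphere 0 1) / s ^ (DIM('a) - 1))"
      using s C(1) by (simp add: sp \<mu>.emeasure_eq_measure flip: ennreal_mult)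
    also have "\<dots> \<le> ennreal (C' / s ^ (DIM('a) - 1))"
      unfolding C'_def using s C(1) by (intro ennreal_leI divide_right_mono mult_left_mono) auto
    finally show ?thesis .
  qed
  ultimately show ?thesis
    by blast
qed

section \<open>Inequalities for powers\<close>

lemma ennreal_powr_le:
  assumes "x \<le> ennreal y" "0 \<le> p"
  shows "ennreal_powr x p \<le> ennreal (y powr p)"
proof -
  have "x \<noteq> \<infinity>"
    using assms(1) by (auto simp: top_unique)
  \<comment> \<open>For negative \<open>y\<close>, \<open>ennreal y\<close> is 0 and forces
    \<open>x = 0\<close>; the maximum covers this case.\<close>
  moreover have "enn2real x \<le> max 0 y"
    using assms(1) by (cases "0 \<le> y") (auto simp: ennreal_neg enn2real_leI)
  ultimately show ?thesis
    using assms
    by (cases "0 \<le> y")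
       (auto simp: ennreal_powr_def ennreal_neg intro!: ennreal_leI powr_mono2)
qed

text \<open>Splitting off one factor \<open>x\<close> linearises the power: it reduces the integral
  of a power of the cap mass to the integral of the mass itself.\<close>

lemma powr_le_mult_of_le:
  fixes x M p :: real
  assumes "0 \<le> x" "x \<le> M" "1 \<le> p"
  shows "x powr p \<le> M powr (p - 1) * x"
proof -
  have "x powr p = x powr (p - 1) * x"
    using assms by (cases "x = 0") (auto simp: powr_diff)
  also have "\<dots> \<le> M powr (p - 1) * x"
    using assms by (auto intro!: mult_right_mono powr_mono2)
  finally show ?thesis .
qed

section \<open>The radial integral\<close>

text \<open>The integrand vanishes unless \<open>r\<close> is within 1 of \<open>s\<close>, and
  \<theta> is confined to a cap that does not depend on \<open>r\<close>. On the domain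
  \<open>r \<ge> s / 2\<close>, so the weight is at most \<open>(2 / s) powr (1 + \<alpha>)\<close>;
  the factor 2 is the length of the window around \<open>s\<close>.\<close>

lemma nn_integral_radial_le:
  fixes \<mu> :: "'a::euclidean_space measure"
  assumes \<mu>: "sets \<mu> = sets (restrict_space borel (sphere 0 1))"
    and "0 < \<alpha>" "norm \<xi> = 1" "0 < s"
  shows "(\<integral>\<^sup>+r\<in>{s / 2..2 * s}.
            ((\<integral>\<^sup>+\<theta>. indicator {\<theta>. norm (s *\<^sub>R \<xi> + r *\<^sub>R \<theta>) < 1} \<theta> \<partial>\<mu>)
              * ennreal (1 / r powr (1 + \<alpha>))) \<partial>lborel)
       \<le> emeasure \<mu> {\<theta> \<in> sphere 0 1. norm (\<xi> + \<theta>) < 2 / s} * ennreal (2 * (2 / s) powr (1 + \<alpha>))"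
    (is "?I \<le> ?E * _")
proof -
  have sp: "space \<mu> = sphere 0 1"
    using sets_eq_imp_space_eq[OF \<mu>] by (simp add: space_restrict_space)
  have [measurable]: "(\<lambda>x. x) \<in> measurable \<mu> borel"
    by (auto simp: measurable_cong_sets[OF \<mu> refl] intro!: measurable_restrict_space1)
  have cap: "{\<theta> \<in> sphere 0 1. norm (\<xi> + \<theta>) < 2 / s} \<in> sets \<mu>"
  proof -
    have "{\<theta> \<in> space \<mu>. norm (\<xi> + \<theta>) < 2 / s} \<in> sets \<mu>"
      by measurable
    then show ?thesis
      by (simp add: sp)
  qed
  \<comment> \<open>The dominating function lives on the whole window \<open>{s - 1..s + 1}\<close>,
    whether or not it lies inside \<open>{s / 2..2 * s}\<close>.\<close>
  have pt: "(\<integral>\<^sup>+\<theta>. indicator {\<theta>. norm (s *\<^sub>R \<xi> + r *\<^sub>R \<theta>) < 1} \<theta> \<partial>\<mu>)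
      * ennreal (1 / r powr (1 + \<alpha>)) * indicator {s / 2..2 * s} r
      \<le> ?E * ennreal ((2 / s) powr (1 + \<alpha>)) * indicator {s - 1..s + 1} r" for r :: real
  proof (cases "r \<in> {s / 2..2 * s}")
    case True
    then have r: "s / 2 \<le> r" "0 < r"
      using assms by auto
    have "(\<integral>\<^sup>+\<theta>. indicator {\<theta>. norm (s *\<^sub>R \<xi> + r *\<^sub>R \<theta>) < 1} \<theta> \<partial>\<mu>)
        \<le> (\<integral>\<^sup>+\<theta>. indicator {\<theta> \<in> sphere 0 1. norm (\<xi> + \<theta>) < 2 / s} \<theta>
                 * indicator {s - 1..s + 1} r \<partial>\<mu>)"
    proof (intro nn_integral_mono)
      fix \<theta> assume "\<theta> \<in> space \<mu>"
      then have "norm \<theta> = 1"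
        by (simp add: sp)
      then show "(indicator {\<theta>. norm (s *\<^sub>R \<xi> + r *\<^sub>R \<theta>) < 1} \<theta> :: ennreal)
          \<le> indicator {\<theta> \<in> sphere 0 1. norm (\<xi> + \<theta>) < 2 / s} \<theta> * indicator {s - 1..s + 1} r"
        using norm_scaleR_add_scaleR_less[of \<xi> \<theta> s r 1] assms r
        by (auto simp: indicator_def abs_less_iff)
    qed
    also have "\<dots> = ?E * indicator {s - 1..s + 1} r"
      using cap by (simp add: nn_integral_multc)
    finally have *: "(\<integral>\<^sup>+\<theta>. indicator {\<theta>. norm (s *\<^sub>R \<xi> + r *\<^sub>R \<theta>) < 1} \<theta> \<partial>\<mu>)
        \<le> ?E * indicator {s - 1..s + 1} r" .
    have "1 / r powr (1 + \<alpha>) = (1 / r) powr (1 + \<alpha>)"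
      using r by (simp add: powr_divide)
    also have "\<dots> \<le> (2 / s) powr (1 + \<alpha>)"
      using r assms by (intro powr_mono2) (auto simp: field_simps)
    finally have "ennreal (1 / r powr (1 + \<alpha>)) \<le> ennreal ((2 / s) powr (1 + \<alpha>))"
      by (rule ennreal_leI)
    from mult_mono[OF * this] show ?thesis
      using True by (simp add: mult_ac)
  qed simp
  have "?I \<le> (\<integral>\<^sup>+r. ?E * ennreal ((2 / s) powr (1 + \<alpha>)) * indicator {s - 1..s + 1} r \<partial>lborel)"
    by (intro nn_integral_mono) (rule pt)
  also have "\<dots> = ?E * (ennreal ((2 / s) powr (1 + \<alpha>)) * 2)"
    by (subst nn_integral_cmult_indicator) (auto simp: mult_ac)
  also have "ennreal ((2 / s) powr (1 + \<alpha>)) * 2 = ennreal (2 * (2 / s) powr (1 + \<alpha>))"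
    by (simp add: ennreal_mult mult_ac)
  finally show ?thesis .
qed

section \<open>Combination of the estimates\<close>

theorem proposition4p4:
  fixes \<mu> :: "(real ^ 'n) measure" and \<alpha> c\<^sub>0 :: real
  assumes N: "CARD('n) \<ge> 2"
    and alpha: "0 < \<alpha>" "\<alpha> < 2"
    and borel: "sets \<mu> = sets (restrict_space borel (sphere 0 1))"
    and finite: "emeasure \<mu> (sphere 0 1) < \<infinity>"
    and symmetric: "\<And>A. A \<in> sets \<mu> \<Longrightarrow> emeasure \<mu> (uminus ` A) = emeasure \<mu> A"
    and c0: "0 < c\<^sub>0"
    and nondegenerate:
      "(INF \<zeta>\<in>sphere 0 1. \<integral>\<^sup>+\<theta>. ennreal (\<bar>\<zeta> \<bullet> \<theta>\<bar> powr \<alpha>) \<partial>\<mu>) \<ge> ennreal c\<^sub>0"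
  shows "\<exists>C>0. \<forall>s>2.
    (\<integral>\<^sup>+\<xi>. ennreal_powr
        (\<integral>\<^sup>+r\<in>{s / 2..2 * s}.
           ((\<integral>\<^sup>+\<theta>. indicator {\<theta>. norm (s *\<^sub>R \<xi> + r *\<^sub>R \<theta>) < 1} \<theta> \<partial>\<mu>)
             * ennreal (1 / r powr (1 + \<alpha>))) \<partial>lborel)
        (real CARD('n) / \<alpha>)
      \<partial>(sphere_surface_measure :: (real ^ 'n) measure))
    \<le> ennreal (C / s ^ (2 * CARD('n) - 1))"
proof -
  let ?N = "CARD('n)"
  define p where "p = real ?N / \<alpha>"
  \<comment> \<open>This holds because \<open>\<alpha> < 2 \<le> N\<close>, and it is what the
    linearisation of the power requires.\<close>
  have p: "1 \<le> p"
    using N alpha by (simp add: p_def field_simps)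
  have sp: "space \<mu> = sphere 0 1"
    using sets_eq_imp_space_eq[OF borel] by (simp add: space_restrict_space)
  interpret finite_measure \<mu>
    by standard (use finite sp in auto)
  define M where "M = measure \<mu> (sphere 0 1) + 1"
  have M: "M > 0"
    by (simp add: M_def add_nonneg_pos)
  obtain D where D: "D > 0" "\<And>s. s \<ge> 1 \<Longrightarrow>
    (\<integral>\<^sup>+\<xi>. emeasure \<mu> {\<theta> \<in> sphere 0 1. norm (\<xi> + \<theta>) < 2 / s} \<partial>sphere_surface_measure)
      \<le> ennreal (D / s ^ (?N - 1))"
    using nn_integral_emeasure_cap_le[OF borel finite_measure_axioms] by auto
  \<comment> \<open>The first two factors come from the \<open>p\<close>-th power of the radial
    constant \<open>K\<close>, the third from linearising the power of the cap mass, and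
    \<open>D\<close> from the average over \<xi>.\<close>
  define C where "C = 2 powr p * 2 powr (p + ?N) * M powr (p - 1) * D"
  have "C > 0"
    using D(1) M by (simp add: C_def)
  moreover have "(\<integral>\<^sup>+\<xi>. ennreal_powr
        (\<integral>\<^sup>+r\<in>{s / 2..2 * s}.
           ((\<integral>\<^sup>+\<theta>. indicator {\<theta>. norm (s *\<^sub>R \<xi> + r *\<^sub>R \<theta>) < 1} \<theta> \<partial>\<mu>)
             * ennreal (1 / r powr (1 + \<alpha>))) \<partial>lborel) p
      \<partial>(sphere_surface_measure :: (real ^ 'n) measure))
    \<le> ennreal (C / s ^ (2 * ?N - 1))" if s: "s > 2" for s :: real
  proof -
    let ?A = "\<lambda>\<xi>. {\<theta> \<in> sphere 0 1. norm (\<xi> + \<theta> :: real ^ 'n) < 2 / s}"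
    define K where "K = 2 * (2 / s) powr (1 + \<alpha>)"
    have K: "K powr p \<le> 2 powr p * 2 powr (p + ?N) / s ^ ?N"
    proof -
      have exponent: "(1 + \<alpha>) * p = p + ?N"
        using alpha by (simp add: p_def field_simps)
      have "K powr p = 2 powr p * (2 / s) powr (p + ?N)"
        by (simp only: K_def powr_mult powr_powr exponent)
      also have "\<dots> = 2 powr p * (2 powr (p + ?N) / (s powr p * s ^ ?N))"
        using s by (simp only: powr_divide powr_add[of s] powr_realpow)
      \<comment> \<open>The extra decay \<open>s powr p \<ge> 1\<close> is given away;
        \<open>s ^ N\<close> suffices.\<close>
      also have "\<dots> \<le> 2 powr p * (2 powr (p + ?N) / (1 * s ^ ?N))"
        using s p by (intro mult_left_mono divide_left_mono mult_right_mono mult_pos_pos)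
          (auto intro: ge_one_powr_ge_zero)
      finally show ?thesis
        by simp
    qed
    have pt: "ennreal_powr
        (\<integral>\<^sup>+r\<in>{s / 2..2 * s}.
           ((\<integral>\<^sup>+\<theta>. indicator {\<theta>. norm (s *\<^sub>R \<xi> + r *\<^sub>R \<theta>) < 1} \<theta> \<partial>\<mu>)
             * ennreal (1 / r powr (1 + \<alpha>))) \<partial>lborel) p
      \<le> ennreal (K powr p * M powr (p - 1)) * emeasure \<mu> (?A \<xi>)"
      if "\<xi> \<in> space sphere_surface_measure" for \<xi> :: "real ^ 'n"
    proof -
      have "norm \<xi> = 1"
        using that by simp
      from nn_integral_radial_le[OF borel alpha(1) this, of s] s
      have "(\<integral>\<^sup>+r\<in>{s / 2..2 * s}.
           ((\<integral>\<^sup>+\<theta>. indicator {\<theta>. norm (s *\<^sub>R \<xi> + r *\<^sub>R \<theta>) < 1} \<theta> \<partial>\<mu>)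
             * ennreal (1 / r powr (1 + \<alpha>))) \<partial>lborel)
          \<le> ennreal (K * measure \<mu> (?A \<xi>))"
        by (simp add: K_def emeasure_eq_measure mult_ac flip: ennreal_mult)
      then have "ennreal_powr
        (\<integral>\<^sup>+r\<in>{s / 2..2 * s}.
           ((\<integral>\<^sup>+\<theta>. indicator {\<theta>. norm (s *\<^sub>R \<xi> + r *\<^sub>R \<theta>) < 1} \<theta> \<partial>\<mu>)
             * ennreal (1 / r powr (1 + \<alpha>))) \<partial>lborel) p
          \<le> ennreal ((K * measure \<mu> (?A \<xi>)) powr p)"
        using p by (intro ennreal_powr_le) auto
      also have "(K * measure \<mu> (?A \<xi>)) powr p = K powr p * measure \<mu> (?A \<xi>) powr p"
        by (simp add: powr_mult K_def)
      also have "\<dots> \<le> K powr p * (M powr (p - 1) * measure \<mu> (?A \<xi>))"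
      proof (intro mult_left_mono powr_le_mult_of_le)
        have "measure \<mu> (?A \<xi>) \<le> measure \<mu> (space \<mu>)"
          by (rule bounded_measure)
        then show "measure \<mu> (?A \<xi>) \<le> M"
          by (simp add: M_def sp)
      qed (use p in auto)
      finally show ?thesis
        by (simp add: emeasure_eq_measure ennreal_leI mult.assoc flip: ennreal_mult)
    qed
    have [measurable]: "(\<lambda>\<xi>. emeasure \<mu> (?A \<xi>)) \<in> borel_measurable sphere_surface_measure"
      using s by (intro borel_measurable_emeasure_cap borel) (simp add: sigma_finite_measure_axioms)
    have "(\<integral>\<^sup>+\<xi>. ennreal_powr
        (\<integral>\<^sup>+r\<in>{s / 2..2 * s}.
           ((\<integral>\<^sup>+\<theta>. indicator {\<theta>. norm (s *\<^sub>R \<xi> + r *\<^sub>R \<theta>) < 1} \<theta> \<partial>\<mu>)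
             * ennreal (1 / r powr (1 + \<alpha>))) \<partial>lborel) p
      \<partial>(sphere_surface_measure :: (real ^ 'n) measure))
      \<le> (\<integral>\<^sup>+\<xi>. ennreal (K powr p * M powr (p - 1)) * emeasure \<mu> (?A \<xi>) \<partial>sphere_surface_measure)"
      by (intro nn_integral_mono pt)
    also have "\<dots> = ennreal (K powr p * M powr (p - 1))
        * (\<integral>\<^sup>+\<xi>. emeasure \<mu> (?A \<xi>) \<partial>sphere_surface_measure)"
      by (rule nn_integral_cmult) measurable
    also have "\<dots> \<le> ennreal (2 powr p * 2 powr (p + ?N) / s ^ ?N * M powr (p - 1))
        * ennreal (D / s ^ (?N - 1))"
      using s K by (intro mult_mono D(2) ennreal_leI mult_right_mono) auto
    also have "\<dots> = ennreal (C / (s ^ ?N * s ^ (?N - 1)))"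
      using s D(1) by (simp add: C_def flip: ennreal_mult)
    \<comment> \<open>The radial bound contributes \<open>N\<close> powers of \<open>s\<close> and
      the cap average \<open>N - 1\<close>; the natural subtraction is exact since
      \<open>N \<ge> 2\<close>.\<close>
    also have "s ^ ?N * s ^ (?N - 1) = s ^ (2 * ?N - 1)"
      using N by (simp flip: power_add add: mult_2)
    finally show ?thesis .
  qed
  ultimately show ?thesis
    unfolding p_def by blast
qed

end
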